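(* Let $0\le\epsilon$, $0\le\delta\le1$, let $D_{\mathcal X}$ be a probability distribution on $\mathcal X$, and let $q$ be a query. If a mechanism $M:\mathcal X^n\times\mathcal Q\to\mathcal R$ is $(\epsilon,\delta)$-differentially private with respect to $q$, then it satisfies $(\epsilon,\delta)$-Local-Max-Information (LMI) with respect to $q$ and the product distribution over $\mathcal X^n$ induced by $D_{\mathcal X}$ (i.e. $n$ i.i.d. samples from $D_{\mathcal X}$).
   Context: $\mathcal X$, $\mathcal Q$, $\mathcal R$ are countable sets and $n\in\mathbb N$. A mechanism is a possibly randomized function $M:\mathcal X^n\times\mathcal Q\to\mathcal R$; for fixed $q$ write $D(r\mid s)=\Pr[M(s,q)=r]$ and $D(\mathbf r\mid s)=\Pr[M(s,q)\in\mathbf r]$. Differential privacy: $M$ is $(\epsilon,\delta)$-differentially private with respect to $q$ if for all $s_1,s_2\in\mathcal X^n$ differing in only one element and all $\mathbf r\subseteq\mathcal R$, $D(\mathbf r\mid s_1)\le e^\epsilon D(\mathbf r\mid s_2)+\delta$. Induced distributions: for a distribution $D_{\mathcal X^n}$ on $\mathcal X^n$ write $D(s)=D_{\mathcal X^n}(s)$, $D(r)=\sum_sD(s)D(r\mid s)$, $D(x\mid s)=\frac1n|\{i:s_i=x\}|$, $D(x)=\sum_sD(s)D(x\mid s)$. The joint distribution on $\mathcal X\times\mathcal R$ is $D_{(\mathcal X,\mathcal R)}(x,r)=\sum_sD(s)D(x\mid s)D(r\mid s)$ and the product distribution is $D_{\mathcal X\otimes\mathcal R}(x,r)=D(x)D(r)$.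 Local Max Information: $M$ satisfies $(\epsilon,\delta)$-LMI with respect to $D_{\mathcal X^n}$ and $q$ if for every $\mathbf b\subseteq\mathcal X\times\mathcal R$, $D_{(\mathcal X,\mathcal R)}(\mathbf b)\le e^\epsilon D_{\mathcal X\otimes\mathcal R}(\mathbf b)+\delta$ and $D_{\mathcal X\otimes\mathcal R}(\mathbf b)\le e^\epsilon D_{(\mathcal X,\mathcal R)}(\mathbf b)+\delta$. *)

theory Defs
  imports "HOL-Probability.Probability"
begin

text \<open>
  A sample set in \<open>X\<^sup>n\<close> is a list of length \<open>n\<close>.  A mechanism \<open>M : X\<^sup>n \<times> Q \<rightarrow> R\<close> maps a pair of a
  sample set and a query to a distribution on responses; so \<open>pmf (M (s, q)) r\<close> is \<open>D(r | s)\<close> and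
  \<open>measure_pmf.prob (M (s, q)) E\<close> is \<open>D(E | s)\<close>.  Values of \<open>M\<close> on lists of length
  other than \<open>n\<close> play no role.
\<close>

type_synonym ('x, 'q, 'r) mechanism = "'x list \<times> 'q \<Rightarrow> 'r pmf"

definition neighbouring :: "nat \<Rightarrow> 'x list \<Rightarrow> 'x list \<Rightarrow> bool" where
  "neighbouring n s1 s2 \<longleftrightarrow>
     length s1 = n \<and> length s2 = n \<and> card {i. i < n \<and> s1 ! i \<noteq> s2 ! i} = 1"

definition differentially_private ::
  "nat \<Rightarrow> ('x, 'q, 'r) mechanism \<Rightarrow> 'q \<Rightarrow> real \<Rightarrow> real \<Rightarrow> bool" where
  "differentially_private n M q \<epsilon> \<delta> \<longleftrightarrow>
     (\<forall>s1 s2 E. neighbouring n s1 s2 \<longrightarrow>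
        measure_pmf.prob (M (s1, q)) E \<le> exp \<epsilon> * measure_pmf.prob (M (s2, q)) E + \<delta>)"

text \<open>\<open>D(x | s)\<close>; only meaningful for nonempty \<open>s\<close>.\<close>

definition empirical_pmf :: "'x list \<Rightarrow> 'x pmf" where
  "empirical_pmf s = map_pmf (\<lambda>i. s ! i) (pmf_of_set {..<length s})"

text \<open>
  The distributions induced by a distribution \<open>DS\<close> on sample sets: \<open>D(r)\<close>, \<open>D(x)\<close>, the joint
  distribution and the product distribution.  Given \<open>s\<close>, element and response are independent.
\<close>

definition response_pmf :: "('x, 'q, 'r) mechanism \<Rightarrow> 'x list pmf \<Rightarrow> 'q \<Rightarrow> 'r pmf" where
  "response_pmf M DS q = bind_pmf DS (\<lambda>s. M (s, q))"

definition element_pmf :: "'x list pmf \<Rightarrow> 'x pmf" where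
  "element_pmf DS = bind_pmf DS empirical_pmf"

definition joint_pmf :: "('x, 'q, 'r) mechanism \<Rightarrow> 'x list pmf \<Rightarrow> 'q \<Rightarrow> ('x \<times> 'r) pmf" where
  "joint_pmf M DS q = bind_pmf DS (\<lambda>s. pair_pmf (empirical_pmf s) (M (s, q)))"

definition product_pmf :: "('x, 'q, 'r) mechanism \<Rightarrow> 'x list pmf \<Rightarrow> 'q \<Rightarrow> ('x \<times> 'r) pmf" where
  "product_pmf M DS q = pair_pmf (element_pmf DS) (response_pmf M DS q)"

definition local_max_information ::
  "('x, 'q, 'r) mechanism \<Rightarrow> 'x list pmf \<Rightarrow> 'q \<Rightarrow> real \<Rightarrow> real \<Rightarrow> bool" where
  "local_max_information M DS q \<epsilon> \<delta> \<longleftrightarrow>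
     (\<forall>B. measure_pmf.prob (joint_pmf M DS q) B
             \<le> exp \<epsilon> * measure_pmf.prob (product_pmf M DS q) B + \<delta> \<and>
          measure_pmf.prob (product_pmf M DS q) B
             \<le> exp \<epsilon> * measure_pmf.prob (joint_pmf M DS q) B + \<delta>)"

text \<open>The induced distributions have the expected mass functions.\<close>

lemma pmf_empirical_pmf:
  assumes "s \<noteq> []"
  shows "pmf (empirical_pmf s) x = 1 / real (length s) * real (card {i. i < length s \<and> s ! i = x})"
proof -
  have "{..<length s} \<inter> (\<lambda>i. s ! i) -` {x} = {i. i < length s \<and> s ! i = x}"
    by auto
  moreover have "{..<length s} \<noteq> {}"
    using assms by auto
  ultimately show ?thesis
    by (simp add: empirical_pmf_def pmf_map measure_pmf_of_set)
qed

lemma pmf_bind_eq_infsum: "pmf (bind_pmf p f) y = (\<Sum>\<^sub>\<infinity>s. pmf p s * pmf (f s) y)"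
proof -
  have "Infinite_Set_Sum.abs_summable_on (\<lambda>s. pmf p s * pmf (f s) y) UNIV"
    by (rule abs_summable_on_comparison_test'[OF pmf_abs_summable[of p UNIV]])
       (simp add: mult_left_le pmf_le_1)
  then show ?thesis
    by (simp add: pmf_bind pmf_expectation_eq_infsetsum infsetsum_infsum)
qed

lemma pmf_response_pmf:
  "pmf (response_pmf M DS q) r = (\<Sum>\<^sub>\<infinity>s. pmf DS s * pmf (M (s, q)) r)"
  by (simp add: response_pmf_def pmf_bind_eq_infsum)

lemma pmf_element_pmf:
  "pmf (element_pmf DS) x = (\<Sum>\<^sub>\<infinity>s. pmf DS s * pmf (empirical_pmf s) x)"
  by (simp add: element_pmf_def pmf_bind_eq_infsum)

lemma pmf_joint_pmf:
  "pmf (joint_pmf M DS q) (x, r) =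
     (\<Sum>\<^sub>\<infinity>s. pmf DS s * pmf (empirical_pmf s) x * pmf (M (s, q)) r)"
  by (simp add: joint_pmf_def pmf_bind_eq_infsum pmf_pair mult.assoc)

lemma pmf_product_pmf:
  "pmf (product_pmf M DS q) (x, r) = pmf (element_pmf DS) x * pmf (response_pmf M DS q) r"
  by (simp add: product_pmf_def pmf_pair)

lemma pmf_replicate_pmf:
  "length s = n \<Longrightarrow> pmf (replicate_pmf n p) s = (\<Prod>i<n. pmf p (s ! i))"
proof (induction n arbitrary: s)
  case 0
  then show ?case by simp
next
  case (Suc n)
  then obtain x xs where s: "s = x # xs" and len: "length xs = n"
    by (auto simp: length_Suc_conv)
  have "replicate_pmf (Suc n) p = map_pmf (\<lambda>(x, xs). x # xs) (pair_pmf p (replicate_pmf n p))"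
    by (simp add: pair_pmf_def map_bind_pmf)
  moreover have "inj (\<lambda>(x :: 'a, xs). x # xs)"
    by (auto simp: inj_on_def)
  ultimately have "pmf (replicate_pmf (Suc n) p) s = pmf (pair_pmf p (replicate_pmf n p)) (x, xs)"
    using pmf_map_inj'[of "\<lambda>(x, xs). x # xs" "pair_pmf p (replicate_pmf n p)" "(x, xs)"]
    by (simp add: s)
  then show ?case
    using Suc.IH[OF len] by (simp add: pmf_pair s prod.lessThan_Suc_shift del: replicate_pmf.simps prod.lessThan_Suc)
qed

end

theory Submission
  imports Defs
begin

text \<open>
  Resampling the \<open>i\<close>-th entry of an i.i.d.\ sample \<open>s\<close> by an independent \<open>x\<close> does not change the
  law of the sample, and the new entry is \<open>x\<close>.  So the joint distribution is the law of \<open>(x, r)\<close>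
  for uniform \<open>i\<close>, \<open>x \<sim> D\<^sub>X\<close>, i.i.d.\ \<open>s\<close> and \<open>r \<sim> M (s[i := x])\<close>, whereas the product
  distribution has \<open>r \<sim> M s\<close> instead.  Since \<open>s\<close> and \<open>s[i := x]\<close> are equal or neighbouring, both
  inequalities hold conditionally on \<open>(i, x, s)\<close>, and hence on average.
\<close>

text \<open>By induction, since the entries are independent. At the head, the old entry is drawn
  only to be overwritten, so its draw averages out.\<close>

lemma replicate_pmf_resample:
  assumes "i < n"
  shows "map_pmf (\<lambda>s. (s ! i, s)) (replicate_pmf n p) =
    bind_pmf p (\<lambda>x. map_pmf (\<lambda>s. (x, s[i := x])) (replicate_pmf n p))"
  using assms
proof (induction n arbitrary: i)
  case 0
  then show ?case by simp
next
  case (Suc n)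
  show ?case
  proof (cases i)
    case 0
    then show ?thesis
      by (simp add: map_bind_pmf)
  next
    case (Suc j)
    let ?S = "replicate_pmf n p"
    have IH: "map_pmf (\<lambda>s. (s ! j, s)) ?S = bind_pmf p (\<lambda>x. map_pmf (\<lambda>s. (x, s[j := x])) ?S)"
      using Suc.IH Suc.prems Suc by simp
    have "map_pmf (\<lambda>s. (s ! i, s)) (replicate_pmf (Suc n) p) =
        bind_pmf p (\<lambda>y. map_pmf (\<lambda>(x, s). (x, y # s)) (map_pmf (\<lambda>s. (s ! j, s)) ?S))"
      by (simp add: Suc map_bind_pmf map_pmf_comp) (simp add: map_pmf_def)
    also have "\<dots> = bind_pmf p (\<lambda>y. bind_pmf p (\<lambda>x. map_pmf (\<lambda>s. (x, y # s[j := x])) ?S))"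
      by (simp add: IH map_bind_pmf map_pmf_comp)
    \<comment> \<open>The kept head \<open>y\<close> and the new entry \<open>x\<close> are
      independent draws, so \<open>x\<close> can be moved outside.\<close>
    also have "\<dots> = bind_pmf p (\<lambda>x. bind_pmf p (\<lambda>y. map_pmf (\<lambda>s. (x, y # s[j := x])) ?S))"
      by (rule bind_commute_pmf)
    also have "\<dots> = bind_pmf p (\<lambda>x. map_pmf (\<lambda>s. (x, s[i := x])) (replicate_pmf (Suc n) p))"
      by (simp add: Suc map_bind_pmf) (simp add: map_pmf_def)
    finally show ?thesis .
  qed
qed

lemma map_nth_replicate_pmf:
  assumes "i < n"
  shows "map_pmf (\<lambda>s. s ! i) (replicate_pmf n p) = p"
proof -
  have "map_pmf (\<lambda>s. s ! i) (replicate_pmf n p) =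
      map_pmf fst (map_pmf (\<lambda>s. (s ! i, s)) (replicate_pmf n p))"
    by (simp add: map_pmf_comp)
  also have "\<dots> = p"
    by (simp add: replicate_pmf_resample[OF assms] map_bind_pmf map_pmf_comp bind_return_pmf')
  finally show ?thesis .
qed

text \<open>The uniform index depends on \<open>s\<close> only through its length, which is
  \<open>n\<close> on the support, so it can be drawn before the sample.\<close>

lemma bind_replicate_empirical_pmf:
  "bind_pmf (replicate_pmf n p) (\<lambda>s. bind_pmf (empirical_pmf s) (f s)) =
    bind_pmf (pmf_of_set {..<n}) (\<lambda>i. bind_pmf (replicate_pmf n p) (\<lambda>s. f s (s ! i)))"
proof -
  have "bind_pmf (replicate_pmf n p) (\<lambda>s. bind_pmf (empirical_pmf s) (f s)) =
      bind_pmf (replicate_pmf n p) (\<lambda>s. bind_pmf (pmf_of_set {..<n}) (\<lambda>i. f s (s ! i)))"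
    by (rule bind_pmf_cong) (auto simp: empirical_pmf_def bind_map_pmf set_replicate_pmf)
  then show ?thesis
    by (simp add: bind_commute_pmf[of "replicate_pmf n p"])
qed

lemma element_pmf_replicate:
  assumes "n \<ge> 1"
  shows "element_pmf (replicate_pmf n p) = p"
proof -
  have "element_pmf (replicate_pmf n p) =
      bind_pmf (pmf_of_set {..<n}) (\<lambda>i. map_pmf (\<lambda>s. s ! i) (replicate_pmf n p))"
    using bind_replicate_empirical_pmf[of n p "\<lambda>_. return_pmf"]
    by (simp add: element_pmf_def bind_return_pmf' map_pmf_def)
  \<comment> \<open>\<open>n \<ge> 1\<close> makes \<open>{..<n}\<close> nonempty, so the support of
    \<open>pmf_of_set {..<n}\<close> consists of valid indices.\<close>
  also have "\<dots> = bind_pmf (pmf_of_set {..<n}) (\<lambda>_. p)"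
    using assms by (intro bind_pmf_cong refl map_nth_replicate_pmf) (auto simp: lessThan_empty_iff)
  finally show ?thesis by simp
qed

lemma joint_pmf_replicate:
  assumes "n \<ge> 1"
  shows "joint_pmf M (replicate_pmf n p) q =
    bind_pmf (pmf_of_set {..<n}) (\<lambda>i. bind_pmf p (\<lambda>x. bind_pmf (replicate_pmf n p)
      (\<lambda>s. map_pmf (Pair x) (M (s[i := x], q)))))"
proof -
  let ?S = "replicate_pmf n p"
  have "joint_pmf M ?S q =
      bind_pmf (pmf_of_set {..<n}) (\<lambda>i. bind_pmf ?S (\<lambda>s. map_pmf (Pair (s ! i)) (M (s, q))))"
    using bind_replicate_empirical_pmf[of n p "\<lambda>s x. map_pmf (Pair x) (M (s, q))"]
    by (simp add: joint_pmf_def pair_pmf_def map_pmf_def)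
  also have "\<dots> = bind_pmf (pmf_of_set {..<n}) (\<lambda>i. bind_pmf p (\<lambda>x. bind_pmf ?S
      (\<lambda>s. map_pmf (Pair x) (M (s[i := x], q)))))"
  proof (intro bind_pmf_cong refl)
    fix i assume "i \<in> set_pmf (pmf_of_set {..<n})"
    then have i: "i < n"
      using assms by (auto simp: lessThan_empty_iff)
    \<comment> \<open>The response law is a function of the pair \<open>(s ! i, s)\<close> alone,
      which is the pair whose law resampling describes.\<close>
    have "bind_pmf ?S (\<lambda>s. map_pmf (Pair (s ! i)) (M (s, q))) =
        bind_pmf (map_pmf (\<lambda>s. (s ! i, s)) ?S) (\<lambda>(x, s). map_pmf (Pair x) (M (s, q)))"
      by (simp add: bind_map_pmf)
    also have "\<dots> = bind_pmf p (\<lambda>x. bind_pmf ?S (\<lambda>s. map_pmf (Pair x) (M (s[i := x], q))))"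
      by (simp add: replicate_pmf_resample[OF i] bind_assoc_pmf bind_map_pmf)
    finally show "bind_pmf ?S (\<lambda>s. map_pmf (Pair (s ! i)) (M (s, q))) = \<dots>" .
  qed
  finally show ?thesis .
qed

text \<open>The index is a dummy draw that gives this law the same nesting as the joint one, so that
  the two can be compared draw by draw.\<close>

lemma product_pmf_replicate:
  assumes "n \<ge> 1"
  shows "product_pmf M (replicate_pmf n p) q =
    bind_pmf (pmf_of_set {..<n}) (\<lambda>_. bind_pmf p (\<lambda>x. bind_pmf (replicate_pmf n p)
      (\<lambda>s. map_pmf (Pair x) (M (s, q)))))"
  by (simp add: product_pmf_def element_pmf_replicate[OF assms] response_pmf_def pair_pmf_def
      map_pmf_def bind_assoc_pmf)

lemma prob_bind_pmf:
  "measure_pmf.prob (bind_pmf p f) B = measure_pmf.expectation p (\<lambda>a. measure_pmf.prob (f a) B)"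
  unfolding measure_pmf_bind
  by (subst measure_pmf.measure_bind[where N = "count_space UNIV"])
     (auto simp: space_subprob_algebra measurable_pmf_measure1 prob_space_imp_subprob_space
        measure_pmf.prob_space_axioms)

text \<open>Averaging is monotone and linear, and \<open>p\<close> has total mass 1, so
  \<open>d\<close> survives as \<open>d\<close> and nested draws do not accumulate loss.\<close>

lemma prob_bind_pmf_le:
  assumes "\<And>a. a \<in> set_pmf p \<Longrightarrow>
    measure_pmf.prob (f a) B \<le> c * measure_pmf.prob (g a) B + d"
  shows "measure_pmf.prob (bind_pmf p f) B \<le> c * measure_pmf.prob (bind_pmf p g) B + d"
proof -
  have int: "integrable (measure_pmf p) (\<lambda>a. measure_pmf.prob (h a) B)" for h :: "'a \<Rightarrow> 'b pmf"
    by (rule measure_pmf.integrable_const_bound[where B = 1]) auto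
  have "measure_pmf.prob (bind_pmf p f) B \<le>
      measure_pmf.expectation p (\<lambda>a. c * measure_pmf.prob (g a) B + d)"
    unfolding prob_bind_pmf
    by (rule integral_mono_AE) (auto simp: int assms AE_measure_pmf_iff)
  also have "\<dots> = c * measure_pmf.prob (bind_pmf p g) B + d"
    by (simp add: int prob_bind_pmf)
  finally show ?thesis .
qed

lemma neighbouring_list_update:
  assumes "length s = n" "i < n" "s ! i \<noteq> x"
  shows "neighbouring n s (s[i := x])" "neighbouring n (s[i := x]) s"
proof -
  have "{j. j < n \<and> s ! j \<noteq> s[i := x] ! j} = {i}"
       "{j. j < n \<and> s[i := x] ! j \<noteq> s ! j} = {i}"
    using assms by (auto simp: nth_list_update split: if_splits)
  then show "neighbouring n s (s[i := x])" "neighbouring n (s[i := x]) s"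
    using assms(1) by (simp_all add: neighbouring_def)
qed

lemma differentially_private_list_update:
  assumes dp: "differentially_private n M q \<epsilon> \<delta>"
    and "0 \<le> \<epsilon>" "0 \<le> \<delta>" and s: "length s = n" "i < n"
  shows "measure_pmf.prob (M (s[i := x], q)) E \<le> exp \<epsilon> * measure_pmf.prob (M (s, q)) E + \<delta>"
    and "measure_pmf.prob (M (s, q)) E \<le> exp \<epsilon> * measure_pmf.prob (M (s[i := x], q)) E + \<delta>"
proof -
  \<comment> \<open>If \<open>s ! i = x\<close>, the two lists coincide and are not neighbouring;
    the bound then comes from \<open>exp \<epsilon> \<ge> 1\<close> and
    \<open>\<delta> \<ge> 0\<close>.\<close>
  have "a \<le> exp \<epsilon> * a + \<delta>" if "0 \<le> a" for a
    using mult_right_mono[of 1 "exp \<epsilon>" a] that assms by simp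
  then show "measure_pmf.prob (M (s[i := x], q)) E \<le> exp \<epsilon> * measure_pmf.prob (M (s, q)) E + \<delta>"
    and "measure_pmf.prob (M (s, q)) E \<le> exp \<epsilon> * measure_pmf.prob (M (s[i := x], q)) E + \<delta>"
    using dp neighbouring_list_update[OF s, of x]
    by (cases "s ! i = x"; auto simp: differentially_private_def)+
qed

theorem theorem4p8:
  fixes n :: nat
    and M :: "('x :: countable, 'q :: countable, 'r :: countable) mechanism"
    and DX :: "'x pmf"
    and q :: 'q
    and \<epsilon> \<delta> :: real
  assumes "n \<ge> 1"
    and "0 \<le> \<epsilon>"
    and "0 \<le> \<delta>" and "\<delta> \<le> 1"
    and "differentially_private n M q \<epsilon> \<delta>"
  shows "local_max_information M (replicate_pmf n DX) q \<epsilon> \<delta>"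
proof -
  have bounds: "i < n" if "i \<in> set_pmf (pmf_of_set {..<n})" for i
    using that assms(1) by (auto simp: lessThan_empty_iff)
  have len: "length s = n" if "s \<in> set_pmf (replicate_pmf n DX)" for s
    using that by (auto simp: set_replicate_pmf)
  note dp = differentially_private_list_update[OF assms(5,2,3) len bounds]
  show ?thesis
    unfolding local_max_information_def joint_pmf_replicate[OF assms(1)]
      product_pmf_replicate[OF assms(1)]
    by (intro allI conjI prob_bind_pmf_le) (simp_all add: dp)
qed

end
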